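(* Let $\mathbf{u}=\mathbf{u}(\Delta,E^{\omega})$ be a pseudostandard sequence, where $\Delta\in\{\mathtt{0},\mathtt{1}\}^{\mathbb{N}}$. (i) If $\Delta\in\{\mathtt{0}^{\omega},\mathtt{1}^{\omega},\mathtt{0}\mathtt{1}^{\omega},\mathtt{1}\mathtt{0}^{\omega}\}$, then all non-empty antipalindromic prefixes of $\mathbf{u}$ have minimal attractors of size two. (ii) If $\Delta\notin\{\mathtt{0}^{\omega},\mathtt{1}^{\omega},\mathtt{0}\mathtt{1}^{\omega},\mathtt{1}\mathtt{0}^{\omega}\}$, then all sufficiently long antipalindromic prefixes of $\mathbf{u}$ have minimal attractors of size three.
   Context: All words and sequences are over $\{\mathtt{0},\mathtt{1}\}$; $\varepsilon$ is the empty word; $x^{\omega}=xxx\cdots$. Write $\overline{\mathtt 0}=\mathtt 1$, $\overline{\mathtt 1}=\mathtt 0$. The exchange antimorphism $E$ is $E(w_0w_1\cdots w_{n-1})=\overline{w_{n-1}}\cdots\overline{w_1}\,\overline{w_0}$. A word $w$ is an antipalindrome if $w=E(w)$. The antipalindromic closure $w^{E}$ of $w$ is the shortest antipalindrome having $w$ as a prefix. Given $\Delta=\delta_1\delta_2\cdots$ with $\delta_i\in\{\mathtt 0,\mathtt 1\}$, the pseudostandard sequence $\mathbf{u}(\Delta,E^{\omega})$ is the infinite sequence having as prefixes all the words $w_n$ defined by $w_0=\varepsilon$, $w_{n+1}=(w_n\delta_{n+1})^{E}$. An attractor (string attractor) of a word $w=w_0\cdots w_{n-1}$ is a set $\Gamma\subset\{0,1,\dots,n-1\}$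 such that every non-empty factor of $w$ has an occurrence $w_iw_{i+1}\cdots w_{j-1}$ in $w$ with $\{i,i+1,\dots,j-1\}\cap\Gamma\neq\emptyset$. A minimal attractor of $w$ is an attractor of $w$ of minimum size. *)

theory Defs
  imports "HOL-Library.Stream" "HOL-Library.Sublist"
begin

text \<open>The letter 0 is \<^const>\<open>False\<close> and the letter 1 is \<^const>\<open>True\<close>, so the exchange of
  letters is \<^const>\<open>Not\<close>.\<close>

definition exchange_antimorphism :: "bool list \<Rightarrow> bool list" where
  "exchange_antimorphism w = rev (map Not w)"

definition antipalindrome :: "bool list \<Rightarrow> bool" where
  "antipalindrome w \<longleftrightarrow> w = exchange_antimorphism w"

definition antipalindromic_closure :: "bool list \<Rightarrow> bool list" where
  "antipalindromic_closure w = (THE p. is_arg_min length (\<lambda>q. antipalindrome q \<and> prefix w q) p)"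

text \<open>Streams are indexed from 0: the \<open>n\<close>-th element of \<open>\<Delta>\<close> here is the directive letter with
  index \<open>n + 1\<close>.\<close>

primrec pseudostandard_prefix :: "bool stream \<Rightarrow> nat \<Rightarrow> bool list" where
  "pseudostandard_prefix \<Delta> 0 = []"
| "pseudostandard_prefix \<Delta> (Suc n) =
     antipalindromic_closure (pseudostandard_prefix \<Delta> n @ [\<Delta> !! n])"

definition stream_prefix :: "'a list \<Rightarrow> 'a stream \<Rightarrow> bool" where
  "stream_prefix w s \<longleftrightarrow> stake (length w) s = w"

definition pseudostandard :: "bool stream \<Rightarrow> bool stream" where
  "pseudostandard \<Delta> = (THE u. \<forall>n. stream_prefix (pseudostandard_prefix \<Delta> n) u)"

definition attractor :: "'a list \<Rightarrow> nat set \<Rightarrow> bool" where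
  "attractor w \<Gamma> \<longleftrightarrow> \<Gamma> \<subseteq> {..<length w} \<and>
     (\<forall>v. v \<noteq> [] \<and> sublist v w \<longrightarrow>
       (\<exists>i. i + length v \<le> length w \<and> take (length v) (drop i w) = v \<and>
            {i..<i + length v} \<inter> \<Gamma> \<noteq> {}))"

definition minimal_attractor :: "'a list \<Rightarrow> nat set \<Rightarrow> bool" where
  "minimal_attractor w \<Gamma> \<longleftrightarrow> is_arg_min card (attractor w) \<Gamma>"


text \<open>Both definite descriptions above are well defined.\<close>

lemma length_exchange_antimorphism [simp]:
  "length (exchange_antimorphism w) = length w"
  by (simp add: exchange_antimorphism_def)

lemma antipalindrome_append_exchange: "antipalindrome (w @ exchange_antimorphism w)"
  by (simp add: antipalindrome_def exchange_antimorphism_def rev_map comp_def)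

lemma antipalindrome_nth:
  assumes "antipalindrome p" "i < length p"
  shows "p ! i = (\<not> p ! (length p - Suc i))"
proof -
  have "p ! i = exchange_antimorphism p ! i"
    using assms(1) by (simp add: antipalindrome_def)
  also have "\<dots> = (\<not> p ! (length p - Suc i))"
    using assms(2) by (simp add: exchange_antimorphism_def rev_nth)
  finally show ?thesis .
qed

lemma prefix_nth: "prefix w p \<Longrightarrow> i < length w \<Longrightarrow> p ! i = w ! i"
  by (auto simp: prefix_def nth_append)

lemma antipalindromic_closure_ex1:
  "\<exists>!p. is_arg_min length (\<lambda>q. antipalindrome q \<and> prefix w q) p"
proof (rule ex_ex1I)
  let ?P = "\<lambda>q. antipalindrome q \<and> prefix w q"
  have "?P (w @ exchange_antimorphism w)"
    by (simp add: antipalindrome_append_exchange)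
  from ex_has_least_nat[of ?P, OF this, of length]
  show "\<exists>p. is_arg_min length ?P p"
    unfolding is_arg_min_linorder by blast
next
  fix p q
  assume "is_arg_min length (\<lambda>q. antipalindrome q \<and> prefix w q) p"
    and "is_arg_min length (\<lambda>q. antipalindrome q \<and> prefix w q) q"
  then have p: "antipalindrome p" "prefix w p"
      and p_min: "\<And>r. antipalindrome r \<Longrightarrow> prefix w r \<Longrightarrow> length p \<le> length r"
    and q: "antipalindrome q" "prefix w q"
      and q_min: "\<And>r. antipalindrome r \<Longrightarrow> prefix w r \<Longrightarrow> length q \<le> length r"
    unfolding is_arg_min_linorder by blast+
  have le: "length p \<le> length w + length w"
    using p_min[OF antipalindrome_append_exchange[of w]] by simp
  have eq: "length p = length q"
    using p_min[OF q] q_min[OF p] by simp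
  have "p ! i = q ! i" if i: "i < length p" for i
  proof (cases "i < length w")
    case True
    then show ?thesis by (simp only: prefix_nth[OF p(2)] prefix_nth[OF q(2)])
  next
    case False
    then have "length p - Suc i < length w" using le i by simp
    then have "p ! (length p - Suc i) = q ! (length q - Suc i)"
      unfolding eq by (simp only: prefix_nth[OF p(2)] prefix_nth[OF q(2)])
    then show ?thesis
      using antipalindrome_nth[OF p(1) i] antipalindrome_nth[OF q(1) i[unfolded eq]] by blast
  qed
  with eq show "p = q" by (rule nth_equalityI)
qed

lemma prefix_antipalindromic_closure: "prefix w (antipalindromic_closure w)"
  using theI'[OF antipalindromic_closure_ex1[of w]]
  by (simp add: antipalindromic_closure_def is_arg_min_def)

lemma pseudostandard_prefix_Suc:
  "strict_prefix (pseudostandard_prefix \<Delta> n) (pseudostandard_prefix \<Delta> (Suc n))"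
  using prefix_antipalindromic_closure[of "pseudostandard_prefix \<Delta> n @ [\<Delta> !! n]"]
  by (auto simp: prefix_def strict_prefix_def)

lemma pseudostandard_prefix_mono:
  "m \<le> n \<Longrightarrow> prefix (pseudostandard_prefix \<Delta> m) (pseudostandard_prefix \<Delta> n)"
proof (induction rule: dec_induct)
  case (step n)
  then show ?case
    using pseudostandard_prefix_Suc[of \<Delta> n] prefix_order.trans strict_prefix_def by blast
qed simp

lemma length_pseudostandard_prefix: "n \<le> length (pseudostandard_prefix \<Delta> n)"
proof (induction n)
  case (Suc n)
  then show ?case using prefix_length_less[OF pseudostandard_prefix_Suc[of \<Delta> n]] by simp
qed simp

lemma stream_prefix_iff: "stream_prefix w s \<longleftrightarrow> (\<forall>i<length w. s !! i = w ! i)"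
  by (auto simp: stream_prefix_def list_eq_iff_nth_eq)

lemma pseudostandard_ex1:
  "\<exists>!u. \<forall>n. stream_prefix (pseudostandard_prefix \<Delta> n) u"
proof (rule ex1I)
  let ?u = "smap (\<lambda>i. pseudostandard_prefix \<Delta> (Suc i) ! i) nats"
  have len: "i < length (pseudostandard_prefix \<Delta> (Suc i))" for i
    by (rule less_le_trans[OF lessI length_pseudostandard_prefix])
  have agree: "pseudostandard_prefix \<Delta> m ! i = pseudostandard_prefix \<Delta> n ! i"
    if "i < length (pseudostandard_prefix \<Delta> m)" "i < length (pseudostandard_prefix \<Delta> n)" for m n i
    using that pseudostandard_prefix_mono[of m n \<Delta>] pseudostandard_prefix_mono[of n m \<Delta>]
    by (metis nat_le_linear prefix_nth)
  show "\<forall>n. stream_prefix (pseudostandard_prefix \<Delta> n) ?u"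
    unfolding stream_prefix_iff using agree[OF len]
    by (simp del: pseudostandard_prefix.simps)
  fix v
  assume "\<forall>n. stream_prefix (pseudostandard_prefix \<Delta> n) v"
  then have "v !! i = ?u !! i" for i
    unfolding stream_prefix_iff using len by (simp del: pseudostandard_prefix.simps)
  then have "smap ((!!) v) nats = smap ((!!) ?u) nats"
    by (intro stream.map_cong0)
  then show "v = ?u"
    by (rule box_equals[OF _ stream_smap_nats[symmetric] stream_smap_nats[symmetric]])
qed

end

theory Submission
  imports Defs
begin

text \<open>Write \<open>W n\<close> for the antipalindromic prefixes. If the letter \<open>\<delta> n\<close> last occurred in the directive
  sequence at index \<open>j\<close>, then \<open>W (n + 1)\<close> extends \<open>W n\<close> with period \<open>p = |W n| - |W j|\<close>. So an attractor of
  \<open>W n\<close> containing some \<open>g \<le> |W j|\<close> becomes an attractor of \<open>W (n + 1)\<close> on replacing \<open>g\<close> by \<open>g + p \<le> |W n|\<close>,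
  and this bound allows a further step with the same letter. An attractor with
  one such movable element for each letter, and one element that never moves, exists at the first
  change of letter; if only one letter recurs, two elements suffice.

  Conversely, the \<open>W n\<close> are concatenations of blocks \<open>a, \<not> a\<close> and \<open>\<not> a, a\<close>, where \<open>a\<close> is the first letter and the
  second block is never repeated. If all six non-constant words of length 3 occur, then two positions
  can meet occurrences of all of them and of all words of length 2 only if both \<open>a, \<not> a\<close> and \<open>\<not> a, a\<close> are repeated
  somewhere, which is impossible.\<close>

subsection \<open>The palindromic structure of the prefixes\<close>

lemma exchange_antimorphism_append:
  "exchange_antimorphism (u @ v) = exchange_antimorphism v @ exchange_antimorphism u"
  by (simp add: exchange_antimorphism_def)

text \<open>In odd length, the middle letter would be its own complement.\<close>

lemma antipalindrome_even_length:
  assumes "antipalindrome w"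
  shows "even (length w)"
proof (rule ccontr)
  assume odd: "odd (length w)"
  then have "length w div 2 < length w" "length w - Suc (length w div 2) = length w div 2"
    by presburger+
  with antipalindrome_nth[OF assms] show False by metis
qed

text \<open>Applying the antimorphism to \<open>w = v @ y\<close> reverses the order of the two
  parts and leaves \<open>w\<close> fixed, so the image of \<open>v\<close> ends
  \<open>w\<close>.\<close>

lemma antipalindrome_suffix:
  assumes "antipalindrome w" "prefix v w"
  shows "w = take (length w - length v) w @ exchange_antimorphism v"
proof -
  obtain y where y: "w = v @ y" using assms(2) by (auto simp: prefix_def)
  have "w = exchange_antimorphism w" using assms(1) by (simp add: antipalindrome_def)
  then have "w = exchange_antimorphism y @ exchange_antimorphism v"
    using y by (metis exchange_antimorphism_append)
  moreover from this have "take (length w - length v) w = exchange_antimorphism y"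
    using y by (metis add_diff_cancel_left' append_eq_conv_conj length_append length_exchange_antimorphism)
  ultimately show ?thesis by simp
qed

lemma antipalindromic_closure_eqI:
  assumes "antipalindrome q" "prefix w q"
    and "\<And>r. antipalindrome r \<Longrightarrow> prefix w r \<Longrightarrow> length q \<le> length r"
  shows "antipalindromic_closure w = q"
  unfolding antipalindromic_closure_def
  using assms by (intro the1_equality[OF antipalindromic_closure_ex1]) (auto simp: is_arg_min_linorder)

lemma
  shows antipalindrome_antipalindromic_closure: "antipalindrome (antipalindromic_closure w)"
    and antipalindromic_closure_least: "antipalindrome r \<Longrightarrow> prefix w r \<Longrightarrow> length (antipalindromic_closure w) \<le> length r"
  using theI'[OF antipalindromic_closure_ex1[of w], folded antipalindromic_closure_def]
  by (simp_all add: is_arg_min_linorder)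

lemma antipalindrome_pseudostandard_prefix: "antipalindrome (pseudostandard_prefix \<Delta> n)"
  by (cases n) (simp_all add: antipalindrome_antipalindromic_closure antipalindrome_def[of "[]"] exchange_antimorphism_def)

lemma prefix_snoc_pseudostandard_prefix:
  assumes "i < n"
  shows "prefix (pseudostandard_prefix \<Delta> i @ [\<Delta> !! i]) (pseudostandard_prefix \<Delta> n)"
proof -
  have "prefix (pseudostandard_prefix \<Delta> i @ [\<Delta> !! i]) (pseudostandard_prefix \<Delta> (Suc i))"
    by (simp add: prefix_antipalindromic_closure)
  then show ?thesis
    using pseudostandard_prefix_mono[of "Suc i" n \<Delta>] assms prefix_order.trans by fastforce
qed

lemma length_pseudostandard_prefix_less:
  "i < n \<Longrightarrow> length (pseudostandard_prefix \<Delta> i) < length (pseudostandard_prefix \<Delta> n)"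
  using prefix_length_le[OF prefix_snoc_pseudostandard_prefix[of i n \<Delta>]] by simp

text \<open>An antipalindromic prefix of \<open>W (n + 1)\<close> longer than \<open>W n\<close>
  begins with \<open>W n\<close> and the letter \<open>\<Delta> !! n\<close>. Since the closure is
  shortest, it is all of \<open>W (n + 1)\<close>.\<close>

lemma antipalindromic_prefix_cases:
  assumes v: "antipalindrome v" "prefix v (pseudostandard_prefix \<Delta> n)"
  obtains i where "i \<le> n" "v = pseudostandard_prefix \<Delta> i"
proof -
  let ?W = "pseudostandard_prefix \<Delta>"
  have "\<exists>i\<le>n. v = ?W i" using v(2)
  proof (induction n)
    case (Suc n)
    show ?case
    proof (cases "prefix v (?W n)")
      case True
      with Suc.IH show ?thesis using le_SucI by blast
    next
      case False
      have *: "prefix (?W n @ [\<Delta> !! n]) (?W (Suc n))"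
        by (rule prefix_snoc_pseudostandard_prefix) simp
      have "prefix (?W n @ [\<Delta> !! n]) v"
        using prefix_same_cases[OF Suc.prems *] False by auto
      then have "length (?W (Suc n)) \<le> length v"
        using antipalindromic_closure_least[OF v(1)] by simp
      with Suc.prems have "v = ?W (Suc n)"
        by (auto simp: prefix_def)
      then show ?thesis by blast
    qed
  qed auto
  with that show ?thesis by blast
qed

text \<open>Two overlapping occurrences of \<open>W n\<close>, at the two ends of an antipalindrome, overlap in an
  antipalindrome, which is one of the \<open>W i\<close>.\<close>

lemma antipalindromic_extension_length:
  fixes \<Delta> n
  defines "w \<equiv> pseudostandard_prefix \<Delta> n"
  assumes r: "antipalindrome r" "prefix (w @ [c]) r"
  shows "2 * length w < length r \<or>
    (\<exists>i<n. \<Delta> !! i = c \<and> length r + length (pseudostandard_prefix \<Delta> i) = 2 * length w)"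
proof (cases "2 * length w < length r")
  case False
  have w: "antipalindrome w" unfolding w_def by (rule antipalindrome_pseudostandard_prefix)
  have lr: "length w < length r" using prefix_length_le[OF r(2)] by simp
  define d where "d = length r - length w"
  have d: "0 < d" "d \<le> length w" "length r = length w + d"
    using False lr by (auto simp: d_def)
  have pw: "prefix w r" using r(2) by (auto simp: prefix_def)
  have r2: "r = take d r @ w"
    using antipalindrome_suffix[OF r(1) pw] w by (simp add: d_def antipalindrome_def)
  have rw: "take (length w) r = w" using pw by (auto simp: prefix_def)
  \<comment> \<open>\<open>v\<close> is the overlap of the two occurrences of \<open>w\<close> in
    \<open>r\<close>, which start at 0 and at \<open>d\<close>. Being a suffix and a prefix of the
    antipalindrome \<open>w\<close>, it is an antipalindrome.\<close>
  define v where "v = drop d w"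
  have "v = drop d (take (length w) r)" by (simp add: rw v_def)
  also have "\<dots> = take (length w - d) (drop d r)" by (rule drop_take)
  also have "drop d r = w" using d by (subst r2) simp
  finally have vp: "v = take (length w - d) w" .
  have "prefix v w" unfolding vp by (rule take_is_prefix)
  then have "w = take (length w - length v) w @ exchange_antimorphism v"
    by (rule antipalindrome_suffix[OF w])
  moreover have lv: "length v = length w - d" by (simp add: v_def)
  ultimately have "w = take d w @ exchange_antimorphism v" using d by simp
  then have "drop d w = exchange_antimorphism v" using d
    by (metis append_take_drop_id same_append_eq)
  then have av: "antipalindrome v" by (simp add: antipalindrome_def v_def)
  obtain i where i: "i \<le> n" "v = pseudostandard_prefix \<Delta> i"
    using antipalindromic_prefix_cases[OF av] \<open>prefix v w\<close> unfolding w_def by blast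
  have "i \<noteq> n" using i lv d by (auto simp: w_def[symmetric])
  then have "i < n" using i by simp
  \<comment> \<open>The letter after the overlap in the second occurrence of \<open>w\<close> is the
    letter of \<open>r\<close> just after the first occurrence, hence \<open>c\<close>. As
    \<open>v\<close> is some \<open>W i\<close>, the same letter is
    \<open>\<Delta> !! i\<close>.\<close>
  have "w ! length v = r ! (d + length v)"
    using d by (subst r2) (simp add: nth_append)
  also have "d + length v = length w" using lv d by simp
  also have "r ! length w = c" using r(2) by (auto simp: prefix_def nth_append)
  finally have 1: "w ! length v = c" .
  have "w ! length v = \<Delta> !! i"
    using prefix_nth[OF prefix_snoc_pseudostandard_prefix[OF \<open>i < n\<close>], of "length v" \<Delta>] i
    by (simp add: w_def)
  with 1 \<open>i < n\<close> i lv d show ?thesis by (intro disjI2 exI[of _ i]) auto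
qed simp

text \<open>Without an earlier occurrence of the letter, two copies of \<open>w\<close> cannot
  overlap or even touch. Parity then forces at least two letters between them, and two
  suffice.\<close>

lemma pseudostandard_prefix_new_letter:
  fixes \<Delta> n
  defines "w \<equiv> pseudostandard_prefix \<Delta> n"
  assumes "\<And>i. i < n \<Longrightarrow> \<Delta> !! i \<noteq> \<Delta> !! n"
  shows "pseudostandard_prefix \<Delta> (Suc n) = w @ [\<Delta> !! n, \<not> \<Delta> !! n] @ w"
proof -
  have w: "exchange_antimorphism w = w"
    using antipalindrome_pseudostandard_prefix[of \<Delta> n] by (simp add: w_def antipalindrome_def)
  have "antipalindromic_closure (w @ [\<Delta> !! n]) = w @ [\<Delta> !! n, \<not> \<Delta> !! n] @ w"
  proof (rule antipalindromic_closure_eqI)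
    have "exchange_antimorphism (w @ [\<Delta> !! n, \<not> \<Delta> !! n] @ w)
        = w @ exchange_antimorphism [\<Delta> !! n, \<not> \<Delta> !! n] @ w"
      by (simp only: exchange_antimorphism_append w append_assoc)
    then show "antipalindrome (w @ [\<Delta> !! n, \<not> \<Delta> !! n] @ w)"
      by (simp add: antipalindrome_def exchange_antimorphism_def)
    fix r assume r: "antipalindrome r" "prefix (w @ [\<Delta> !! n]) r"
    then have "2 * length w < length r"
      using antipalindromic_extension_length[of r \<Delta> n] assms by auto
    with antipalindrome_even_length[OF r(1)]
    show "length (w @ [\<Delta> !! n, \<not> \<Delta> !! n] @ w) \<le> length r" by simp presburger
  qed simp
  then show ?thesis by (simp add: w_def)
qed

text \<open>The possible overlaps are the \<open>W i\<close> with
  \<open>\<Delta> !! i = \<Delta> !! n\<close>. The largest such \<open>i\<close> gives the longest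
  overlap and so the shortest extension. The second claim says that the new word also ends in
  \<open>w\<close>, which yields its period.\<close>

lemma pseudostandard_prefix_old_letter:
  fixes \<Delta> n
  defines "w \<equiv> pseudostandard_prefix \<Delta> n" and "l \<equiv> \<lambda>j. length (pseudostandard_prefix \<Delta> j)"
  assumes j: "j < n" "\<Delta> !! j = \<Delta> !! n" and last: "\<And>i. j < i \<Longrightarrow> i < n \<Longrightarrow> \<Delta> !! i \<noteq> \<Delta> !! n"
  shows "pseudostandard_prefix \<Delta> (Suc n) = w @ drop (l j) w"
    and "w @ drop (l j) w = take (length w - l j) w @ w"
proof -
  let ?v = "pseudostandard_prefix \<Delta> j"
  have w: "antipalindrome w" unfolding w_def by (rule antipalindrome_pseudostandard_prefix)
  have pv: "prefix (?v @ [\<Delta> !! n]) w"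
    using prefix_snoc_pseudostandard_prefix[OF j(1), of \<Delta>] j(2) by (simp add: w_def)
  then have v: "prefix ?v w" by (auto simp: prefix_def)
  have "exchange_antimorphism ?v = ?v"
    using antipalindrome_pseudostandard_prefix[of \<Delta> j] by (simp add: antipalindrome_def)
  then have s: "w = take (length w - l j) w @ ?v"
    using antipalindrome_suffix[OF w v] by (simp add: l_def)
  have t: "w = ?v @ drop (l j) w" using v by (auto simp: prefix_def l_def)
  show eq: "w @ drop (l j) w = take (length w - l j) w @ w"
    using s t by (metis append_assoc)
  have lj: "l j < length w" using j(1) length_pseudostandard_prefix_less by (simp add: w_def l_def)
  have "w = exchange_antimorphism (drop (l j) w) @ exchange_antimorphism ?v"
    using t w by (metis antipalindrome_def exchange_antimorphism_append)
  then have e: "exchange_antimorphism (drop (l j) w) = take (length w - l j) w"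
    by (metis append_eq_conv_conj length_drop length_exchange_antimorphism)
  have "antipalindromic_closure (w @ [\<Delta> !! n]) = w @ drop (l j) w"
  proof (rule antipalindromic_closure_eqI)
    show "antipalindrome (w @ drop (l j) w)"
      unfolding antipalindrome_def exchange_antimorphism_append e
      using w eq by (simp add: antipalindrome_def[symmetric] antipalindrome_def[of w, THEN iffD1, symmetric])
    have "prefix [\<Delta> !! n] (drop (l j) w)"
      using pv by (auto simp: prefix_def l_def)
    then show "prefix (w @ [\<Delta> !! n]) (w @ drop (l j) w)" by simp
    fix r assume r: "antipalindrome r" "prefix (w @ [\<Delta> !! n]) r"
    from antipalindromic_extension_length[OF r[unfolded w_def]]
    consider "2 * length w < length r"
      | i where "i < n" "\<Delta> !! i = \<Delta> !! n" "length r + l i = 2 * length w"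
      by (auto simp: w_def l_def)
    then show "length (w @ drop (l j) w) \<le> length r"
    proof cases
      case 2
      then have "i \<le> j" using last by (meson not_le)
      then have "l i \<le> l j"
        using length_pseudostandard_prefix_less[of i j \<Delta>] by (cases "i = j") (auto simp: l_def)
      with 2 lj show ?thesis by simp
    qed simp
  qed
  then show "pseudostandard_prefix \<Delta> (Suc n) = w @ drop (l j) w" by (simp add: w_def)
qed

lemma last_occurrence:
  assumes "i < n" "\<Delta> !! i = c"
  obtains j where "i \<le> j" "j < n" "\<Delta> !! j = c" "\<And>m. j < m \<Longrightarrow> m < n \<Longrightarrow> \<Delta> !! m \<noteq> c"
proof -
  define P where "P j \<longleftrightarrow> j < n \<and> \<Delta> !! j = c" for j
  have P: "P i" and bound: "\<And>j. P j \<Longrightarrow> j \<le> n" using assms by (simp_all add: P_def)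
  have "P (Greatest P)" by (rule GreatestI_nat[of P, OF P bound])
  moreover have "m \<le> Greatest P" if "P m" for m by (rule Greatest_le_nat[of P, OF that bound])
  ultimately show thesis using that[of "Greatest P"] P unfolding P_def by (metis not_le)
qed

text \<open>The word is the \<open>k\<close>-th power of \<open>a, \<not> a\<close>. Each step after
  the first overlaps two copies in the word two steps back, so both predecessors enter the
  induction.\<close>

lemma pseudostandard_prefix_constant:
  assumes "\<And>i. i < k \<Longrightarrow> \<Delta> !! i = a"
  shows "length (pseudostandard_prefix \<Delta> k) = 2 * k"
    and "t < 2 * k \<Longrightarrow> pseudostandard_prefix \<Delta> k ! t = (a = even t)"
proof -
  have "length (pseudostandard_prefix \<Delta> k) = 2 * k \<and>
    (\<forall>t < 2 * k. pseudostandard_prefix \<Delta> k ! t = (a = even t))"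
    using assms
  proof (induction k rule: less_induct)
    case (less n)
    consider "n = 0" | "n = 1" | m where "n = Suc (Suc m)"
      by (metis One_nat_def not0_implies_Suc)
    then show ?case
    proof cases
      case 2
      then have "pseudostandard_prefix \<Delta> n = [a, \<not> a]"
        using pseudostandard_prefix_new_letter[of 0 \<Delta>] less.prems by simp
      then show ?thesis using 2 by (auto simp: less_Suc_eq numeral_2_eq_2)
    next
      case (3 m)
      let ?w = "pseudostandard_prefix \<Delta> (Suc m)"
      have IH: "length ?w = 2 * Suc m" "\<And>t. t < 2 * Suc m \<Longrightarrow> ?w ! t = (a = even t)"
        "length (pseudostandard_prefix \<Delta> m) = 2 * m"
        using less.IH[of "Suc m"] less.IH[of m] less.prems 3 by (auto simp del: pseudostandard_prefix.simps)
      have "pseudostandard_prefix \<Delta> n = ?w @ drop (2 * m) ?w"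
        using pseudostandard_prefix_old_letter(1)[of m "Suc m" \<Delta>] 3 less.prems IH(3)
        by (simp del: pseudostandard_prefix.simps snth.simps)
      then show ?thesis using IH 3
        by (auto simp: nth_append simp del: pseudostandard_prefix.simps)
    qed simp
  qed
  then show "length (pseudostandard_prefix \<Delta> k) = 2 * k"
    and "t < 2 * k \<Longrightarrow> pseudostandard_prefix \<Delta> k ! t = (a = even t)" by auto
qed

subsection \<open>Propagating attractors\<close>

text \<open>Factors become ranges of positions, so that occurrences can be moved by index
  arithmetic.\<close>

lemma attractor_iff:
  "attractor w \<Gamma> \<longleftrightarrow> \<Gamma> \<subseteq> {..<length w} \<and>
     (\<forall>i l. 0 < l \<and> i + l \<le> length w \<longrightarrow>
       (\<exists>j. j + l \<le> length w \<and> (\<forall>t<l. w ! (j + t) = w ! (i + t)) \<and> (\<exists>g\<in>\<Gamma>. j \<le> g \<and> g < j + l)))"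
    (is "_ \<longleftrightarrow> _ \<and> ?R")
proof -
  have eq: "take l (drop j w) = take l (drop i w) \<longleftrightarrow> (\<forall>t<l. w ! (j + t) = w ! (i + t))"
    if "i + l \<le> length w" "j + l \<le> length w" for i j l
    using that by (auto simp: list_eq_iff_nth_eq)
  have meets: "{j..<j + l} \<inter> \<Gamma> \<noteq> {} \<longleftrightarrow> (\<exists>g\<in>\<Gamma>. j \<le> g \<and> g < j + l)" for j l
    by auto
  have "(\<forall>v. v \<noteq> [] \<and> sublist v w \<longrightarrow>
       (\<exists>i. i + length v \<le> length w \<and> take (length v) (drop i w) = v \<and>
            {i..<i + length v} \<inter> \<Gamma> \<noteq> {})) \<longleftrightarrow> ?R" (is "?L \<longleftrightarrow> _")
  proof
    assume L: ?L
    show ?R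
    proof (intro allI impI)
      fix i l assume il: "0 < l \<and> i + l \<le> length w"
      let ?v = "take l (drop i w)"
      have "?v \<noteq> []" using il by auto
      moreover have "sublist ?v w"
        by (metis append_take_drop_id sublist_def)
      ultimately show "\<exists>j. j + l \<le> length w \<and> (\<forall>t<l. w ! (j + t) = w ! (i + t)) \<and>
          (\<exists>g\<in>\<Gamma>. j \<le> g \<and> g < j + l)"
        using L[rule_format, of ?v] il eq[of i l] meets by (auto; metis)
    qed
  next
    assume R: ?R
    show ?L
    proof (intro allI impI)
      fix v assume v: "v \<noteq> [] \<and> sublist v w"
      then obtain x y where w: "w = x @ v @ y" by (auto simp: sublist_def)
      then have v2: "take (length v) (drop (length x) w) = v" "length x + length v \<le> length w"
        by auto
      then show "\<exists>i. i + length v \<le> length w \<and> take (length v) (drop i w) = v \<and>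
            {i..<i + length v} \<inter> \<Gamma> \<noteq> {}"
        using R[rule_format, of "length v" "length x"] v eq[of "length x" "length v"] meets by auto
    qed
  qed
  then show ?thesis by (simp add: attractor_def)
qed

text \<open>The longer word \<open>q\<close> has period \<open>length w - l\<close>, like \<open>w\<close>. A factor of \<open>w\<close> that meets \<open>g\<close> is shifted by
  this period. A factor of \<open>q\<close> starting in the first period but leaving \<open>w\<close> meets the new
  position in any case.\<close>

lemma attractor_periodic_extension:
  fixes w l
  defines "q \<equiv> w @ drop l w" and "p \<equiv> length w - l"
  assumes q: "q = take p w @ w" and l: "l < length w" "g \<le> l"
    and att: "attractor w (insert g F)"
  shows "attractor q (insert (g + p) F)"
proof -
  have lq: "length q = length w + p" by (simp add: q_def p_def)
  have p: "0 < p" "p + l = length w" using l by (auto simp: p_def)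
  have pre: "q ! t = w ! t" if "t < length w" for t using that by (simp add: q_def nth_append)
  have shift: "q ! (t + p) = w ! t" for t using p by (subst q) (simp add: nth_append)
  have "\<exists>j. j + n \<le> length q \<and> (\<forall>t<n. q ! (j + t) = q ! (i + t)) \<and>
      (\<exists>h\<in>insert (g + p) F. j \<le> h \<and> h < j + n)" if "0 < n" "i + n \<le> length q" for i n
    using that
  \<comment> \<open>A factor starting after the first period is moved back by \<open>p\<close>,
    which leaves only starts below \<open>p\<close>.\<close>
  proof (induction i rule: less_induct)
    case (less i)
    consider "p \<le> i" | "i < p" "length w < i + n" | "i < p" "i + n \<le> length w" by linarith
    then show ?case
    proof cases
      case 1
      then have "i - p < i" "i - p + n \<le> length q" using less.prems p(1) by linarith+
      with less.IH less.prems(1) obtain j where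
          j: "j + n \<le> length q" "\<forall>t<n. q ! (j + t) = q ! (i - p + t)"
          "\<exists>h\<in>insert (g + p) F. j \<le> h \<and> h < j + n"
        by blast
      have "q ! (i - p + t) = q ! (i + t)" if "t < n" for t
        using shift[of "i - p + t"] pre[of "i - p + t"] 1 that less.prems lq by simp
      with j show ?thesis by auto
    next
      case 2
      \<comment> \<open>The bound \<open>g \<le> l\<close> gives
        \<open>g + p \<le> length w\<close>, and the factor runs past that position.\<close>
      then have "i \<le> g + p" "g + p < i + n" using l p by linarith+
      with less.prems show ?thesis by (intro exI[of _ i]) auto
    next
      case 3
      then obtain j h where j: "j + n \<le> length w" "\<forall>t<n. w ! (j + t) = w ! (i + t)"
          "h \<in> insert g F" "j \<le> h" "h < j + n"
        using att less.prems(1) unfolding attractor_iff by metis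
      show ?thesis
      proof (cases "h = g")
        case True
        have "q ! (j + p + t) = q ! (i + t)" if "t < n" for t
          using shift[of "j + t"] pre[of "i + t"] j(2) 3 that by (simp add: ac_simps)
        then show ?thesis using j True lq by (intro exI[of _ "j + p"]) auto
      next
        case False
        then show ?thesis using j 3 lq pre by (intro exI[of _ j]) auto
      qed
    qed
  qed
  moreover have "insert (g + p) F \<subseteq> {..<length q}"
    using att l p lq by (auto simp: attractor_iff)
  ultimately show ?thesis unfolding attractor_iff by blast
qed

text \<open>The hypothesis allows any earlier occurrence \<open>i\<close> of the letter, because the
  last one has a longer \<open>W j\<close>. The bound on \<open>h\<close> is the same hypothesis for
  a later step, with \<open>n\<close> in the role of \<open>i\<close>.\<close>

lemma attractor_pseudostandard_Suc:
  assumes "attractor (pseudostandard_prefix \<Delta> n) (insert g F)"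
    and "i < n" "\<Delta> !! i = \<Delta> !! n" "g \<le> length (pseudostandard_prefix \<Delta> i)"
  obtains h where "attractor (pseudostandard_prefix \<Delta> (Suc n)) (insert h F)"
    "h \<le> length (pseudostandard_prefix \<Delta> n)"
proof -
  let ?W = "pseudostandard_prefix \<Delta>"
  obtain j where j: "i \<le> j" "j < n" "\<Delta> !! j = \<Delta> !! n"
    "\<And>m. j < m \<Longrightarrow> m < n \<Longrightarrow> \<Delta> !! m \<noteq> \<Delta> !! n"
    using last_occurrence[of i n \<Delta> "\<Delta> !! n"] assms(2,3) by metis
  have g: "g \<le> length (?W j)"
    using assms(4) prefix_length_le[OF pseudostandard_prefix_mono[OF j(1), of \<Delta>]] by simp
  have l: "length (?W j) < length (?W n)" by (rule length_pseudostandard_prefix_less[OF j(2)])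
  show ?thesis
    using attractor_periodic_extension[OF _ l g assms(1)] pseudostandard_prefix_old_letter[OF j(2-4)]
      g l by (intro that[of "g + (length (?W n) - length (?W j))"]) auto
qed

text \<open>The three positions start the last block of the first copy of \<open>w\<close>, the
  middle block, and the second copy. Factors inside either copy reduce to factors of the first
  one.\<close>

lemma attractor_first_change:
  assumes len: "length w = 2 * k" "0 < k" and alt: "\<And>t. t < 2 * k \<Longrightarrow> w ! t = (a = even t)"
  shows "attractor (w @ [\<not> a, a] @ w) {2 * k - 2, 2 * k, 2 * k + 2}"
proof -
  define q where "q = w @ [\<not> a, a] @ w"
  have lq: "length q = 4 * k + 2" using len by (simp add: q_def)
  have q: "q ! t = (a = even t)" if "t < 2 * k" for t
    using that alt len by (simp add: q_def nth_append)
  have q': "q ! (2 * k + 2 + t) = (a = even t)" if "t < 2 * k" for t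
    using that alt len by (simp add: q_def nth_append)
  have qm: "q ! (2 * k) = (\<not> a)" "q ! (2 * k + 1) = a"
    using len by (simp_all add: q_def nth_append)
  let ?G = "{2 * k - 2, 2 * k, 2 * k + 2}"
  let ?P = "\<lambda>i l j. j + l \<le> length q \<and> (\<forall>t<l. q ! (j + t) = q ! (i + t)) \<and>
      (\<exists>g\<in>?G. j \<le> g \<and> g < j + l)"
  have left: "\<exists>j. ?P i l j" if il: "0 < l" "i + l \<le> 2 * k" for i l
  proof -
    \<comment> \<open>An even start recurs at the front of the second copy. A single
      \<open>\<not> a\<close> recurs at \<open>2 * k\<close>. Any other odd start recurs as far
      right in the first copy as parity permits, which covers \<open>2 * k - 2\<close>.\<close>
    consider "even i" | "odd i" "l = 1" | "odd i" "even l" | "odd i" "odd l" "3 \<le> l"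
      using il by (cases "l = 1"; cases "l = 2"; fastforce)
    then show ?thesis
    proof cases
      case 1
      have "?P i l (2 * k + 2)" using il 1 lq q q' by auto
      then show ?thesis by blast
    next
      case 2
      have "?P i l (2 * k)" using il 2 lq q qm by auto
      then show ?thesis by blast
    next
      case 3
      have "?P i l (2 * k - 1 - l)" using il 3 lq q by auto presburger+
      then show ?thesis by blast
    next
      case 4
      have "?P i l (2 * k - l)" using il 4 lq q by auto
      then show ?thesis by blast
    qed
  qed
  have "\<exists>j. ?P i l j" if il: "0 < l" "i + l \<le> length q" for i l
  proof -
    consider "i \<le> 2 * k" "2 * k < i + l" | "i \<le> 2 * k + 2" "2 * k + 2 < i + l"
      | "i + l \<le> 2 * k" | "i = 2 * k + 1" "l = 1" | "2 * k + 2 < i"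
      using il by linarith
    then show ?thesis
    proof cases
      case 1
      then have "?P i l i" using il by auto
      then show ?thesis by blast
    next
      case 2
      then have "?P i l i" using il by auto
      then show ?thesis by blast
    next
      case 3
      then show ?thesis using left il by blast
    next
      case 4
      have "?P i l (2 * k + 2)" using 4 q'[of 0] qm len lq by auto
      then show ?thesis by blast
    next
      case 5
      define i' where "i' = i - (2 * k + 2)"
      have i': "i = 2 * k + 2 + i'" using 5 by (simp add: i'_def)
      have "i' + l \<le> 2 * k" using il lq i' by simp
      moreover from this obtain j where "?P i' l j" using left il by blast
      moreover have "q ! (i + t) = q ! (i' + t)" if "t < l" for t
        using that q[of "i' + t"] q'[of "i' + t"] calculation(1) i' by (simp add: ac_simps)
      ultimately show ?thesis by auto
    qed
  qed
  moreover have "?G \<subseteq> {..<length q}" using lq len by auto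
  ultimately show ?thesis unfolding attractor_iff q_def by blast
qed

text \<open>When only one letter occurs from index \<open>i\<close> on, a single element moves and
  \<open>F\<close> stays fixed. The induction also carries the bound of the moving element by some
  \<open>W j\<close> with \<open>i \<le> j\<close>.\<close>

lemma attractor_pseudostandard_constant:
  assumes "attractor (pseudostandard_prefix \<Delta> m) (insert g F)"
    and "i < m" "g \<le> length (pseudostandard_prefix \<Delta> i)"
    and const: "\<And>j. i \<le> j \<Longrightarrow> \<Delta> !! j = c" and n: "m \<le> n"
  obtains h where "attractor (pseudostandard_prefix \<Delta> n) (insert h F)"
proof -
  have "\<exists>h. attractor (pseudostandard_prefix \<Delta> n) (insert h F) \<and>
      (\<exists>j<n. i \<le> j \<and> h \<le> length (pseudostandard_prefix \<Delta> j))"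
    using n
  proof (induction rule: dec_induct)
    case base
    then show ?case using assms by blast
  next
    case (step n)
    then obtain h j where h: "attractor (pseudostandard_prefix \<Delta> n) (insert h F)" "j < n" "i \<le> j"
      "h \<le> length (pseudostandard_prefix \<Delta> j)" by blast
    then have "\<Delta> !! j = \<Delta> !! n" using const by simp
    from attractor_pseudostandard_Suc[OF h(1,2) this h(4)] h(2,3) show ?case
      by (metis lessI less_or_eq_imp_le le_trans)
  qed
  with that show thesis by blast
qed

lemma attractor_pseudostandard_three:
  assumes "0 < k" and const: "\<And>i. i < k \<Longrightarrow> \<Delta> !! i = a" and k: "\<Delta> !! k \<noteq> a" and n: "k < n"
  obtains x y z where "attractor (pseudostandard_prefix \<Delta> n) {x, y, z}"
proof -
  let ?W = "pseudostandard_prefix \<Delta>"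
  \<comment> \<open>\<open>g c\<close> is the element that moves when the letter \<open>c\<close> is
    read, and \<open>t\<close> never moves.\<close>
  have "\<exists>g t. attractor (?W n) {g True, g False, t} \<and>
      (\<forall>c. \<exists>i<n. \<Delta> !! i = c \<and> g c \<le> length (?W i))"
    using Suc_leI[OF n]
  proof (induction rule: dec_induct)
    case base
    \<comment> \<open>These values are exactly the lengths of \<open>W (k - 1)\<close> and
      \<open>W k\<close>, and those indices carry the letters \<open>a\<close> and
      \<open>\<not> a\<close>.\<close>
    define g where "g c = (if c = a then 2 * k - 2 else 2 * k)" for c
    have len: "length (?W i) = 2 * i" if "i \<le> k" for i
      using pseudostandard_prefix_constant(1)[of i \<Delta> a] const that by auto
    have "?W (Suc k) = ?W k @ [\<not> a, a] @ ?W k"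
      using pseudostandard_prefix_new_letter[of k \<Delta>] const k by (simp del: pseudostandard_prefix.simps)
    then have "attractor (?W (Suc k)) {2 * k - 2, 2 * k, 2 * k + 2}"
      using attractor_first_change[of "?W k" k a] pseudostandard_prefix_constant[of k \<Delta> a]
        const \<open>0 < k\<close> by (metis (no_types, lifting))
    moreover have "{g True, g False, 2 * k + 2} = {2 * k - 2, 2 * k, 2 * k + 2}"
      by (cases a) (auto simp: g_def)
    moreover have "\<exists>i<Suc k. \<Delta> !! i = c \<and> g c \<le> length (?W i)" for c
    proof (cases "c = a")
      case True
      then show ?thesis using const len \<open>0 < k\<close> by (intro exI[of _ "k - 1"]) (auto simp: g_def)
    next
      case False
      then show ?thesis using k len by (intro exI[of _ k]) (auto simp: g_def)
    qed
    ultimately show ?case by metis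
  next
    case (step n)
    then obtain g t where g: "attractor (?W n) {g True, g False, t}"
      "\<And>c. \<exists>i<n. \<Delta> !! i = c \<and> g c \<le> length (?W i)" by blast
    define c where "c = \<Delta> !! n"
    have "{g True, g False, t} = insert (g c) {g (\<not> c), t}" by (cases c) auto
    with g(1) have "attractor (?W n) (insert (g c) {g (\<not> c), t})" by simp
    moreover from g(2) obtain i where "i < n" "\<Delta> !! i = \<Delta> !! n" "g c \<le> length (?W i)"
      unfolding c_def by blast
    ultimately obtain h where h: "attractor (?W (Suc n)) (insert h {g (\<not> c), t})"
      "h \<le> length (?W n)" by (rule attractor_pseudostandard_Suc)
    let ?g = "g(c := h)"
    have "{?g True, ?g False, t} = insert h {g (\<not> c), t}" by (cases c) auto
    moreover have "\<exists>i<Suc n. \<Delta> !! i = e \<and> ?g e \<le> length (?W i)" for e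
      using g(2)[of e] h(2) c_def by (cases "e = c") (auto simp: less_Suc_eq)
    ultimately show ?case using h(1) by metis
  qed
  with that show thesis by blast
qed

section \<open>Two-element starting attractors for the exceptional sequences\<close>

lemma attractor_two_letters: "attractor [a, \<not> a] {0, 1}"
proof -
  have "\<exists>j. j + l \<le> 2 \<and> (\<forall>t<l. [a, \<not> a] ! (j + t) = [a, \<not> a] ! (i + t)) \<and>
      (\<exists>g\<in>{0, 1}. j \<le> g \<and> g < j + l)" if "0 < l" "i + l \<le> 2" for i l :: nat
    using that by (intro exI[of _ i] conjI bexI[of _ i]) auto
  then show ?thesis unfolding attractor_iff by auto
qed

text \<open>This is \<open>W 2\<close> after a change of letter. Position 1 lies within the reach of
  \<open>W 1\<close> and can move with \<open>\<not> a\<close>, while 3 stays fixed.\<close>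

lemma attractor_first_change_two: "attractor [a, \<not> a, \<not> a, a, a, \<not> a] {1, 3}"
proof -
  let ?w = "[a, \<not> a, \<not> a, a, a, \<not> a]"
  have "\<exists>j. j + l \<le> 6 \<and> (\<forall>t<l. ?w ! (j + t) = ?w ! (i + t)) \<and>
      (\<exists>g\<in>{1, 3}. j \<le> g \<and> g < j + l)" if "0 < l" "i + l \<le> 6" for i l :: nat
  proof (cases "\<exists>g\<in>{1, 3}. i \<le> g \<and> g < i + l")
    case True
    then show ?thesis using that by blast
  next
    case False
    \<comment> \<open>These are the only ranges that avoid both 1 and 3.\<close>
    with that consider "i = 0" "l = 1" | "i = 2" "l = 1" | "i = 4" "l = 1" | "i = 4" "l = 2"
      | "i = 5" "l = 1"
      by (simp; linarith)
    then show ?thesis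
    proof cases
      case 1
      then show ?thesis by (intro exI[of _ 3]) simp
    next
      case 2
      then show ?thesis by (intro exI[of _ 1]) simp
    next
      case 3
      then show ?thesis by (intro exI[of _ 3]) simp
    next
      case 4
      then show ?thesis by (intro exI[of _ 0]) (simp add: less_Suc_eq numeral_2_eq_2)
    next
      case 5
      then show ?thesis by (intro exI[of _ 1]) simp
    qed
  qed
  moreover have "length ?w = 6" by simp
  moreover have "{1, 3} \<subseteq> {..<6::nat}" by auto
  ultimately show ?thesis unfolding attractor_iff by metis
qed

subsection \<open>Lower bounds\<close>

lemma finite_attractor: "attractor w \<Gamma> \<Longrightarrow> finite \<Gamma>"
  using finite_subset[of \<Gamma> "{..<length w}"] by (auto simp: attractor_def)

text \<open>The first and last letters differ, and each letter that occurs must stand at some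
  attractor position.\<close>

lemma two_le_card_attractor:
  assumes "attractor w \<Gamma>" "w \<noteq> []" "antipalindrome w"
  shows "2 \<le> card \<Gamma>"
proof -
  have hit: "\<exists>g\<in>\<Gamma>. w ! g = w ! i" if i: "i < length w" for i
  proof -
    obtain j g where "w ! j = w ! i" "g \<in> \<Gamma>" "j \<le> g" "g < j + 1"
      using assms(1)[unfolded attractor_iff, THEN conjunct2, rule_format, of 1 i] Suc_leI[OF i] by auto
    moreover from this have "g = j" by simp
    ultimately show ?thesis by blast
  qed
  have "w ! 0 = (\<not> w ! (length w - 1))" "0 < length w"
    using antipalindrome_nth[OF assms(3), of 0] assms(2) by auto
  with hit[of 0] hit[of "length w - 1"] obtain g h where "g \<in> \<Gamma>" "h \<in> \<Gamma>" "g \<noteq> h"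
    by (metis diff_less zero_less_one)
  then have "{g, h} \<subseteq> \<Gamma>" "card {g, h} = 2" by auto
  with card_mono[OF finite_attractor[OF assms(1)]] show ?thesis by metis
qed

text \<open>The words that are concatenations of the blocks \<open>a, \<not> a\<close> and \<open>\<not> a, a\<close>, without two
  consecutive blocks of the second kind.\<close>

definition block_coded :: "bool \<Rightarrow> bool list \<Rightarrow> bool" where
  "block_coded a w \<longleftrightarrow> even (length w) \<and>
    (\<forall>i. even i \<and> i + 1 < length w \<longrightarrow> w ! i \<noteq> w ! (i + 1)) \<and>
    (\<forall>i. even i \<and> i + 2 < length w \<longrightarrow> w ! i = a \<or> w ! (i + 2) = a)"

text \<open>The even length of \<open>u\<close> keeps the blocks aligned, so the only new pair of
  neighbours is the last block of \<open>u\<close>, starting at \<open>length u - 2\<close>, and the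
  first block of \<open>v\<close>.\<close>

lemma block_coded_append:
  assumes u: "block_coded a u" and v: "block_coded a v"
    and join: "u ! (length u - 2) = a \<or> v ! 0 = a"
  shows "block_coded a (u @ v)"
  unfolding block_coded_def
proof (intro conjI allI impI)
  have lu: "even (length u)" using u by (simp add: block_coded_def)
  show "even (length (u @ v))" using u v by (simp add: block_coded_def)
  fix i
  { assume i: "even i \<and> i + 1 < length (u @ v)"
    show "(u @ v) ! i \<noteq> (u @ v) ! (i + 1)"
    proof (cases "i < length u")
      case True
      then have "i + 1 < length u" using lu i by presburger
      then show ?thesis using u i unfolding block_coded_def by (simp add: nth_append)
    next
      case False
      then have "even (i - length u)" "i - length u + 1 < length v"
        using lu i by auto
      then show ?thesis using v False unfolding block_coded_def by (simp add: nth_append Suc_diff_le)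
    qed }
  { assume i: "even i \<and> i + 2 < length (u @ v)"
    then have "i + 2 < length u \<or> i + 2 = length u \<or> length u \<le> i"
      using lu by presburger
    then consider "i + 2 < length u" | "i + 2 = length u" | "length u \<le> i" by blast
    then show "(u @ v) ! i = a \<or> (u @ v) ! (i + 2) = a"
    proof cases
      case 1
      then have "u ! i = a \<or> u ! (i + 2) = a" using u i unfolding block_coded_def by blast
      with 1 show ?thesis by (simp add: nth_append)
    next
      case 2
      then have "i = length u - 2" by simp
      then show ?thesis using 2 join by (auto simp: nth_append)
    next
      case 3
      then have "even (i - length u)" "i - length u + 2 < length v"
        using lu i by auto
      then have "v ! (i - length u) = a \<or> v ! (i - length u + 2) = a"
        using v unfolding block_coded_def by blast
      moreover have "i + 2 - length u = i - length u + 2" using 3 by simp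
      ultimately show ?thesis using 3 by (simp add: nth_append)
    qed }
qed

lemma block_coded_drop:
  assumes "block_coded a w" "even l"
  shows "block_coded a (drop l w)"
  unfolding block_coded_def
proof (intro conjI allI impI)
  show "even (length (drop l w))" using assms by (simp add: block_coded_def)
next
  fix i assume "even i \<and> i + 1 < length (drop l w)"
  then have "even (l + i) \<and> l + i + 1 < length w" using assms(2) by auto
  then have "w ! (l + i) \<noteq> w ! (l + i + 1)" using assms(1) unfolding block_coded_def by blast
  then show "drop l w ! i \<noteq> drop l w ! (i + 1)"
    using \<open>even (l + i) \<and> l + i + 1 < length w\<close> by simp
next
  fix i assume "even i \<and> i + 2 < length (drop l w)"
  then have "even (l + i) \<and> l + i + 2 < length w" using assms(2) by auto
  then have "w ! (l + i) = a \<or> w ! (l + i + 2) = a" using assms(1) unfolding block_coded_def by blast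
  then show "drop l w ! i = a \<or> drop l w ! (i + 2) = a"
    using \<open>even (l + i) \<and> l + i + 2 < length w\<close> by simp
qed

text \<open>A non-empty \<open>W n\<close> starts with the block \<open>a, \<not> a\<close> and,
  being an antipalindrome, also ends with it. So no gluing in either form of the next step puts two
  blocks \<open>\<not> a, a\<close> side by side.\<close>

lemma block_coded_pseudostandard_prefix: "block_coded (\<Delta> !! 0) (pseudostandard_prefix \<Delta> n)"
proof (induction n)
  case 0
  show ?case by (simp add: block_coded_def)
next
  case (Suc n)
  let ?W = "pseudostandard_prefix \<Delta>"
  let ?a = "\<Delta> !! 0" and ?c = "\<Delta> !! n"
  have new: "block_coded ?a [?c, \<not> ?c]" by (auto simp: block_coded_def less_Suc_eq)
  show ?case
  proof (cases "n = 0")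
    case True
    then show ?thesis
      using new pseudostandard_prefix_new_letter[of n \<Delta>] by (simp del: pseudostandard_prefix.simps(2))
  next
    case False
    have len: "2 \<le> length (?W n)"
      using False length_pseudostandard_prefix[of n \<Delta>]
        antipalindrome_even_length[OF antipalindrome_pseudostandard_prefix[of \<Delta> n]] by presburger
    have hd: "?W n ! 0 = ?a"
      using prefix_nth[OF prefix_snoc_pseudostandard_prefix[of 0 n \<Delta>], of 0] False by simp
    have "?W n ! (length (?W n) - 2) \<noteq> ?W n ! 1"
      using antipalindrome_nth[OF antipalindrome_pseudostandard_prefix[of \<Delta> n], of 1] len
      by (simp add: numeral_2_eq_2)
    moreover have "?W n ! 0 \<noteq> ?W n ! 1"
      using Suc len unfolding block_coded_def by (metis add_0 even_zero less_le_trans one_less_numeral_iff semiring_norm(76))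
    ultimately have last: "?W n ! (length (?W n) - 2) = ?a" using hd by blast
    show ?thesis
    proof (cases "\<exists>i<n. \<Delta> !! i = ?c")
      case False
      then have eq: "?W (Suc n) = ?W n @ [?c, \<not> ?c] @ ?W n"
        using pseudostandard_prefix_new_letter[of n \<Delta>] by metis
      have "block_coded ?a ([?c, \<not> ?c] @ ?W n)"
        by (rule block_coded_append[OF new Suc]) (use hd in blast)
      with Suc last show ?thesis unfolding eq by (blast intro: block_coded_append)
    next
      case True
      then obtain j where "j < n" "\<Delta> !! j = ?c" "\<And>m. j < m \<Longrightarrow> m < n \<Longrightarrow> \<Delta> !! m \<noteq> ?c"
        using last_occurrence[of _ n \<Delta> ?c] by metis
      then have eq: "?W (Suc n) = ?W n @ drop (length (?W j)) (?W n)"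
        by (rule pseudostandard_prefix_old_letter)
      have "even (length (?W j))"
        by (rule antipalindrome_even_length[OF antipalindrome_pseudostandard_prefix])
      with Suc last show ?thesis
        unfolding eq by (blast intro: block_coded_append block_coded_drop)
    qed
  qed
qed

text \<open>Two positions lie in at most six windows of length 3 and four windows of length 2, so each of the
  six non-constant words of length 3 and each of the four words of length 2 must occur in
  exactly one window. This forces the words of length 5 around the two positions to be complementary, so that two
  consecutive blocks \<open>\<not> a, a\<close> occur.\<close>

lemma no_two_position_cover:
  fixes f :: "nat \<Rightarrow> bool"
  assumes block: "\<And>i. even i \<Longrightarrow> f i \<noteq> f (i + 1)"
    and sep: "\<And>i. even i \<Longrightarrow> f i = a \<or> f (i + 2) = a"
    and two: "\<And>c d. \<exists>i\<in>{x + 1, x + 2, y + 1, y + 2}. f i = c \<and> f (i + 1) = d"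
    and three: "\<And>c d e. \<not> (c = d \<and> d = e) \<Longrightarrow>
      \<exists>i\<in>{x, x + 1, x + 2, y, y + 1, y + 2}. f i = c \<and> f (i + 1) = d \<and> f (i + 2) = e"
  shows False
proof -
  \<comment> \<open>The block conditions as seen from positions \<open>z\<close> to
    \<open>z + 4\<close>, with one disjunct for each parity of \<open>z\<close>.\<close>
  have loc: "(f z \<noteq> f (z + 1) \<and> f (z + 2) \<noteq> f (z + 3) \<and> (f z = a \<or> f (z + 2) = a) \<and>
        (f (z + 2) = a \<or> f (z + 4) = a)) \<or>
      (f (z + 1) \<noteq> f (z + 2) \<and> f (z + 3) \<noteq> f (z + 4) \<and> (f z \<noteq> a \<or> f (z + 1) = a) \<and>
        (f (z + 1) = a \<or> f (z + 3) = a))" for z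
  proof (cases "even z")
    case True
    then have "even (z + 2)" by simp
    then show ?thesis using block[OF True] block[of "z + 2"] sep[OF True] sep[of "z + 2"]
      by (simp add: numeral_eq_Suc)
  next
    case False
    then obtain y where y: "z = y + 1" "even y" by (metis oddE dvd_triv_left)
    have e: "even (y + 2)" "even (y + 4)" using y by simp_all
    show ?thesis unfolding y(1)
      using block[OF y(2)] block[OF e(1)] block[OF e(2)] sep[OF y(2)] sep[OF e(1)]
      by (simp add: numeral_eq_Suc) blast
  qed
  note two' = two[of True True] two[of True False] two[of False True] two[of False False]
  note three' = three[of True True False] three[of True False True] three[of True False False]
    three[of False True True] three[of False True False] three[of False False True]
  show False
    \<comment> \<open>All constraints now concern the letters at \<open>x\<close> to
      \<open>x + 4\<close> and \<open>y\<close> to \<open>y + 4\<close>, so the rest is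
      propositional.\<close>
    using loc[of x] loc[of y] two' three' by (simp add: numeral_eq_Suc) sat
qed

lemma three_le_card_attractor:
  assumes w: "block_coded a w" and att: "attractor w \<Gamma>"
    and fac: "\<And>c d e. \<not> (c = d \<and> d = e) \<Longrightarrow> sublist [c, d, e] w"
  shows "3 \<le> card \<Gamma>"
proof (rule ccontr)
  assume "\<not> 3 \<le> card \<Gamma>"
  then have "card \<Gamma> = 0 \<or> card \<Gamma> = 1 \<or> card \<Gamma> = 2" by linarith
  then obtain x y where xy: "\<Gamma> \<subseteq> {x, y}"
    using finite_attractor[OF att] by (auto simp: card_1_singleton_iff card_2_iff)
  \<comment> \<open>\<open>f\<close> is \<open>w\<close> shifted by two, which avoids subtracting
    from the positions \<open>x\<close> and \<open>y\<close>, and padded on both sides with blocks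
    \<open>a, \<not> a\<close>, which preserve the block conditions.\<close>
  define f where "f i = (if i < 2 then even i = a
    else if i < length w + 2 then w ! (i - 2) else even i = a)" for i
  have fw: "f (i + 2) = w ! i" if "i < length w" for i using that by (simp add: f_def)
  have lw: "even (length w)" using w by (simp add: block_coded_def)
  have occ: "\<exists>j g. j + length v \<le> length w \<and> take (length v) (drop j w) = v \<and>
      (g = x \<or> g = y) \<and> j \<le> g \<and> g < j + length v" if "v \<noteq> []" "sublist v w" for v
    using att that xy unfolding attractor_def by (fastforce simp: disjoint_iff)
  show False
  proof (rule no_two_position_cover)
    fix i :: nat assume i: "even i"
    have "i < 2 \<or> length w + 2 \<le> i \<or> i = i - 2 + 2 \<and> i - 2 + 1 < length w \<and> even (i - 2)"
      using i lw by presburger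
    then consider "i < 2" | "length w + 2 \<le> i" | k where "i = k + 2" "k + 1 < length w" "even k"
      by blast
    note cases = this
    show "f i \<noteq> f (i + 1)"
    proof (cases rule: cases)
      case 1
      then show ?thesis using i by (auto simp: f_def)
    next
      case 2
      then show ?thesis using i by (simp add: f_def)
    next
      case (3 k)
      then have "w ! k \<noteq> w ! (k + 1)" using w unfolding block_coded_def by blast
      with 3 fw[of k] fw[of "k + 1"] show ?thesis by (simp add: ac_simps)
    qed
    show "f i = a \<or> f (i + 2) = a"
    proof (cases rule: cases)
      case (3 k)
      show ?thesis
      proof (cases "k + 2 < length w")
        case True
        then have "w ! k = a \<or> w ! (k + 2) = a" using w 3 unfolding block_coded_def by blast
        with 3 True fw[of k] fw[of "k + 2"] show ?thesis by (simp add: ac_simps)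
      next
        case False
        then show ?thesis using 3 by (simp add: f_def)
      qed
    qed (use i in \<open>auto simp: f_def\<close>)
  next
    fix c d :: bool
    \<comment> \<open>Every word of length 2, even a constant one, extends to a non-constant word of
      length 3.\<close>
    have "sublist [c, d] [c, d, \<not> d]" by (simp add: sublist_def) (metis append_Nil)
    moreover have "sublist [c, d, \<not> d] w" by (rule fac) simp
    ultimately have "sublist [c, d] w" by (rule sublist_order.order_trans)
    from occ[OF _ this] obtain j g where j: "j + 2 \<le> length w" "take 2 (drop j w) = [c, d]"
      "g = x \<or> g = y" "j \<le> g" "g < j + 2" by (auto simp: numeral_2_eq_2)
    have "take 2 (drop j w) ! 0 = c" "take 2 (drop j w) ! 1 = d" by (simp_all add: j(2))
    then have "f (j + 2) = c" "f (j + 2 + 1) = d" using j(1) fw[of j] fw[of "j + 1"]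
      by (simp_all add: ac_simps)
    moreover have "j + 2 \<in> {x + 1, x + 2, y + 1, y + 2}" using j(3-5) by auto
    ultimately show "\<exists>i\<in>{x + 1, x + 2, y + 1, y + 2}. f i = c \<and> f (i + 1) = d" by blast
  next
    fix c d e :: bool
    assume "\<not> (c = d \<and> d = e)"
    from occ[OF _ fac[OF this]] obtain j g where j: "j + 3 \<le> length w"
      "take 3 (drop j w) = [c, d, e]" "g = x \<or> g = y" "j \<le> g" "g < j + 3"
      by (auto simp: numeral_3_eq_3)
    have "take 3 (drop j w) ! 0 = c" "take 3 (drop j w) ! 1 = d" "take 3 (drop j w) ! 2 = e"
      by (simp_all add: j(2))
    then have "f (j + 2) = c" "f (j + 2 + 1) = d" "f (j + 2 + 2) = e"
      using j(1) fw[of j] fw[of "j + 1"] fw[of "j + 2"] by (simp_all add: ac_simps)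
    moreover have "j + 2 \<in> {x, x + 1, x + 2, y, y + 1, y + 2}" using j(3-5) by auto
    ultimately show "\<exists>i\<in>{x, x + 1, x + 2, y, y + 1, y + 2}. f i = c \<and> f (i + 1) = d \<and> f (i + 2) = e"
      by blast
  qed
qed

section \<open>Occurrence of all non-constant words of length three\<close>

lemma stream_eqI: "(\<And>n. s !! n = t !! n) \<Longrightarrow> s = t"
  using smap_alt[of id s t] by (simp add: stream.map_id)

lemma pseudostandard_prefix_1: "pseudostandard_prefix \<Delta> (Suc 0) = [\<Delta> !! 0, \<not> \<Delta> !! 0]"
  using pseudostandard_prefix_new_letter[of 0 \<Delta>] by simp

lemma pseudostandard_prefix_2_change:
  assumes "\<Delta> !! 1 \<noteq> \<Delta> !! 0"
  shows "pseudostandard_prefix \<Delta> 2 =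
    [\<Delta> !! 0, \<not> \<Delta> !! 0, \<not> \<Delta> !! 0, \<Delta> !! 0, \<Delta> !! 0, \<not> \<Delta> !! 0]"
  using pseudostandard_prefix_new_letter[of "Suc 0" \<Delta>] assms pseudostandard_prefix_1[of \<Delta>]
  by (simp add: numeral_2_eq_2 del: pseudostandard_prefix.simps snth.simps)

lemma pseudostandard_prefix_border:
  assumes "m \<le> n"
  obtains x where "pseudostandard_prefix \<Delta> n = x @ pseudostandard_prefix \<Delta> m"
  using antipalindrome_suffix[OF antipalindrome_pseudostandard_prefix pseudostandard_prefix_mono[OF assms]]
    antipalindrome_pseudostandard_prefix[of \<Delta> m] by (metis antipalindrome_def)

text \<open>The three words are the permitted pairs of adjacent blocks. The mixed pairs appear at
  the first change of letter. The pair of equal blocks appears in \<open>W 2\<close> if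
  \<open>k \<ge> 2\<close>, and otherwise once \<open>a\<close> recurs, which fails only for the
  excluded sequence.\<close>

lemma pseudostandard_prefix_block_pairs:
  fixes \<Delta>
  defines "a \<equiv> \<Delta> !! 0"
  assumes "0 < k" and const: "\<And>i. i < k \<Longrightarrow> \<Delta> !! i = a" and k: "\<Delta> !! k \<noteq> a"
    and \<Delta>: "\<Delta> \<noteq> a ## sconst (\<not> a)"
  obtains n where "sublist [a, \<not> a, a, \<not> a] (pseudostandard_prefix \<Delta> n)"
    "sublist [a, \<not> a, \<not> a, a] (pseudostandard_prefix \<Delta> n)"
    "sublist [\<not> a, a, a, \<not> a] (pseudostandard_prefix \<Delta> n)"
proof -
  let ?W = "pseudostandard_prefix \<Delta>"
  have W1: "?W (Suc 0) = [a, \<not> a]" using pseudostandard_prefix_1 by (simp add: a_def)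
  show thesis
  proof (cases "k = 1")
    case True
    with k have W2: "?W 2 = [a, \<not> a, \<not> a, a, a, \<not> a]"
      using pseudostandard_prefix_2_change[of \<Delta>] unfolding a_def by metis
    have "\<exists>m. 0 < m \<and> \<Delta> !! m = a"
    proof (rule ccontr)
      assume *: "\<not> ?thesis"
      have "\<Delta> = a ## sconst (\<not> a)"
      proof (rule stream_eqI)
        fix n show "\<Delta> !! n = (a ## sconst (\<not> a)) !! n"
        proof (cases n)
          case (Suc p)
          then have "\<Delta> !! n = (\<not> a)" using * by blast
          moreover have "(a ## sconst (\<not> a)) !! n = (\<not> a)" using Suc by simp
          ultimately show ?thesis by simp
        qed (simp add: a_def)
      qed
      with \<Delta> show False by simp
    qed
    then obtain m where m: "0 < m" "\<Delta> !! m = a" "\<And>i. 0 < i \<Longrightarrow> i < m \<Longrightarrow> \<Delta> !! i \<noteq> a"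
      using exists_least_iff[of "\<lambda>m. 0 < m \<and> \<Delta> !! m = a"] by blast
    \<comment> \<open>The last earlier occurrence of \<open>a\<close> is at index 0 and
      \<open>W 0\<close> is empty, so the two copies of \<open>W m\<close> touch without
      overlapping.\<close>
    have "?W (Suc m) = ?W m @ ?W m"
      using pseudostandard_prefix_old_letter(1)[of 0 m \<Delta>] m unfolding a_def by simp
    moreover have "m \<noteq> 1" using k m True by metis
    with m(1) have "2 \<le> m" by simp
    then obtain x y where "?W m = x @ ?W 2" "?W m = ?W 2 @ y"
      using pseudostandard_prefix_border pseudostandard_prefix_mono unfolding prefix_def by metis
    ultimately have eq: "?W (Suc m) = x @ [a, \<not> a, \<not> a, a, a, \<not> a, a, \<not> a, \<not> a, a, a, \<not> a] @ y"
      using W2 by (metis append_Cons append_Nil append_assoc)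
    show thesis
    proof (rule that)
      show "sublist [a, \<not> a, a, \<not> a] (?W (Suc m))"
        unfolding eq sublist_def by (intro exI[of _ "x @ [a, \<not> a, \<not> a, a]"] exI) simp
      show "sublist [a, \<not> a, \<not> a, a] (?W (Suc m))"
        unfolding eq sublist_def by (intro exI[of _ x] exI) simp
      show "sublist [\<not> a, a, a, \<not> a] (?W (Suc m))"
        unfolding eq sublist_def by (intro exI[of _ "x @ [a, \<not> a]"] exI) simp
    qed
  next
    case False
    then have "2 \<le> k" using \<open>0 < k\<close> by simp
    have "?W (Suc k) = ?W k @ [\<not> a, a] @ ?W k"
      using pseudostandard_prefix_new_letter[of k \<Delta>] const k by (simp del: pseudostandard_prefix.simps)
    moreover obtain x y where "?W k = x @ ?W (Suc 0)" "?W k = ?W (Suc 0) @ y"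
      using pseudostandard_prefix_border[of "Suc 0" k \<Delta>] pseudostandard_prefix_mono[of "Suc 0" k \<Delta>]
        \<open>0 < k\<close> unfolding prefix_def by (metis Suc_leI)
    ultimately have eq: "?W (Suc k) = x @ [a, \<not> a, \<not> a, a, a, \<not> a] @ y"
      using W1 by (metis append_Cons append_Nil append_assoc)
    have "?W 2 = [a, \<not> a, a, \<not> a]"
      using pseudostandard_prefix_old_letter(1)[of 0 1 \<Delta>] const[of 1] \<open>2 \<le> k\<close> W1
      by (simp add: numeral_2_eq_2 a_def del: pseudostandard_prefix.simps(2) snth.simps)
    moreover have "prefix (?W 2) (?W (Suc k))"
      using pseudostandard_prefix_mono[of 2 "Suc k" \<Delta>] \<open>2 \<le> k\<close> by simp
    ultimately have "prefix [a, \<not> a, a, \<not> a] (?W (Suc k))" by metis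
    show thesis
    proof (rule that)
      show "sublist [a, \<not> a, a, \<not> a] (?W (Suc k))"
        using \<open>prefix [a, \<not> a, a, \<not> a] (?W (Suc k))\<close> by (rule prefix_imp_sublist)
      show "sublist [a, \<not> a, \<not> a, a] (?W (Suc k))"
        unfolding eq sublist_def by (intro exI[of _ x] exI) simp
      show "sublist [\<not> a, a, a, \<not> a] (?W (Suc k))"
        unfolding eq sublist_def by (intro exI[of _ "x @ [a, \<not> a]"] exI) simp
    qed
  qed
qed

text \<open>Each of the three words contains two of the six non-constant words of length 3, and
  together they contain all six.\<close>

lemma sublist_three_of_block_pairs:
  assumes "sublist [a, \<not> a, a, \<not> a] w" "sublist [a, \<not> a, \<not> a, a] w" "sublist [\<not> a, a, a, \<not> a] w"
    and "\<not> (c = d \<and> d = e)"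
  shows "sublist [c, d, e] w"
proof -
  have "sublist [p, q, r] w \<and> sublist [q, r, s] w" if "sublist [p, q, r, s] w" for p q r s
  proof -
    have "sublist [p, q, r] [p, q, r, s]" "sublist [q, r, s] [p, q, r, s]"
      by (metis append_Cons append_Nil sublist_appendI append_Nil2)+
    with that show ?thesis using sublist_order.order_trans by blast
  qed
  note this[OF assms(1)] this[OF assms(2)] this[OF assms(3)]
  then show ?thesis using assms(4) by (cases a; cases c; cases d; cases e) auto
qed

section \<open>Minimal attractors of the antipalindromic prefixes\<close>

lemma minimal_attractorI:
  assumes "attractor w \<Gamma>" "card \<Gamma> \<le> m" "\<And>\<Gamma>'. attractor w \<Gamma>' \<Longrightarrow> m \<le> card \<Gamma>'"
  shows "\<exists>\<Gamma>. minimal_attractor w \<Gamma> \<and> card \<Gamma> = m"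
  using assms unfolding minimal_attractor_def is_arg_min_linorder by (metis order.antisym order.trans)

lemma antipalindromic_stream_prefix_cases:
  assumes "antipalindrome w" "stream_prefix w (pseudostandard \<Delta>)"
  obtains n where "w = pseudostandard_prefix \<Delta> n"
proof -
  \<comment> \<open>\<open>W n\<close> has length at least \<open>n\<close>, so the index
    \<open>length w\<close> is large enough for \<open>w\<close> to be a prefix.\<close>
  let ?v = "pseudostandard_prefix \<Delta> (length w)"
  have "stream_prefix ?v (pseudostandard \<Delta>)"
    using theI'[OF pseudostandard_ex1[of \<Delta>]] unfolding pseudostandard_def by blast
  moreover have "length w \<le> length ?v" by (rule length_pseudostandard_prefix)
  ultimately have "w = take (length w) ?v"
    using assms(2) unfolding stream_prefix_iff by (intro nth_equalityI) auto
  then have "prefix w ?v" by (metis take_is_prefix)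
  with assms(1) that show thesis by (metis antipalindromic_prefix_cases)
qed

theorem corollary9:
  fixes \<Delta> u :: "bool stream"
  assumes "u = pseudostandard \<Delta>"
  shows
    "(\<Delta> \<in> {sconst False, sconst True, False ## sconst True, True ## sconst False} \<longrightarrow>
       (\<forall>w. w \<noteq> [] \<and> antipalindrome w \<and> stream_prefix w u \<longrightarrow>
         (\<exists>\<Gamma>. minimal_attractor w \<Gamma> \<and> card \<Gamma> = 2))) \<and>
     (\<Delta> \<notin> {sconst False, sconst True, False ## sconst True, True ## sconst False} \<longrightarrow>
       (\<exists>N. \<forall>w. length w \<ge> N \<and> antipalindrome w \<and> stream_prefix w u \<longrightarrow>
         (\<exists>\<Gamma>. minimal_attractor w \<Gamma> \<and> card \<Gamma> = 3)))"
proof (intro conjI impI allI)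
  let ?W = "pseudostandard_prefix \<Delta>"
  fix w
  assume \<Delta>: "\<Delta> \<in> {sconst False, sconst True, False ## sconst True, True ## sconst False}"
    and w: "w \<noteq> [] \<and> antipalindrome w \<and> stream_prefix w u"
  then obtain n where n: "w = ?W n"
    using antipalindromic_stream_prefix_cases assms by metis
  with w have "0 < n" by (cases n) auto
  define a where "a = \<Delta> !! 0"
  have W1: "?W (Suc 0) = [a, \<not> a]" using pseudostandard_prefix_1 by (simp add: a_def)
  have att1: "attractor (?W (Suc 0)) {0, 1}"
    unfolding W1 by (rule attractor_two_letters)
  have "\<exists>g h. attractor w {g, h}"
  \<comment> \<open>The second letter tells the constant sequence from the one that changes once,
    after its first letter.\<close>
  proof (cases "\<Delta> !! 1 = a")
    case True
    with \<Delta> have "\<Delta> = sconst a" by (auto simp: a_def)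
    then have "\<Delta> !! j = a" for j by simp
    \<comment> \<open>Starting from \<open>W 1\<close>, position 0 moves and 1 stays fixed.\<close>
    then obtain h where "attractor (?W n) (insert h {1})"
      using attractor_pseudostandard_constant[of \<Delta> "Suc 0" 0 "{1}" 0 a n] att1 \<open>0 < n\<close> by auto
    with n show ?thesis by blast
  next
    case False
    with \<Delta> have c: "\<Delta> = a ## sconst (\<not> a)" by (auto simp: a_def)
    have const: "\<Delta> !! j = (\<not> a)" if "1 \<le> j" for j
      using that by (subst c, cases j) auto
    have "attractor (?W 2) {1, 3}"
      using pseudostandard_prefix_2_change[of \<Delta>] False attractor_first_change_two[of a]
      by (simp only: a_def) metis
    moreover have "1 \<le> length (?W 1)" using W1 by simp
    ultimately have "\<exists>h. attractor (?W n) (insert h {3})" if "2 \<le> n"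
      using attractor_pseudostandard_constant[of \<Delta> 2 1 "{3}" 1 "\<not> a" n] const that by auto
    moreover have "n = 1 \<or> 2 \<le> n" using \<open>0 < n\<close> by linarith
    ultimately show ?thesis using att1 n by (metis One_nat_def)
  qed
  then obtain g h where "attractor w {g, h}" by blast
  then show "\<exists>\<Gamma>. minimal_attractor w \<Gamma> \<and> card \<Gamma> = 2"
    using two_le_card_attractor w by (intro minimal_attractorI) (auto simp: card_insert_if)
next
  let ?W = "pseudostandard_prefix \<Delta>"
  assume \<Delta>: "\<Delta> \<notin> {sconst False, sconst True, False ## sconst True, True ## sconst False}"
  define a where "a = \<Delta> !! 0"
  have "\<Delta> \<noteq> sconst a" "\<Delta> \<noteq> a ## sconst (\<not> a)" using \<Delta> by (cases a; simp)+
  have "\<exists>k. \<Delta> !! k \<noteq> a"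
  proof (rule ccontr)
    assume "\<nexists>k. \<Delta> !! k \<noteq> a"
    then have "\<Delta> = sconst a" by (intro stream_eqI) auto
    with \<open>\<Delta> \<noteq> sconst a\<close> show False by simp
  qed
  then obtain k where k: "\<Delta> !! k \<noteq> a" "\<And>i. i < k \<Longrightarrow> \<Delta> !! i = a"
    using exists_least_iff[of "\<lambda>k. \<Delta> !! k \<noteq> a"] by blast
  then have "0 < k" using a_def by (cases k) auto
  obtain m where m: "sublist [a, \<not> a, a, \<not> a] (?W m)" "sublist [a, \<not> a, \<not> a, a] (?W m)"
    "sublist [\<not> a, a, a, \<not> a] (?W m)"
    using pseudostandard_prefix_block_pairs[of k \<Delta>] \<open>0 < k\<close> k \<open>\<Delta> \<noteq> a ## sconst (\<not> a)\<close>
    unfolding a_def by blast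
  \<comment> \<open>From \<open>m\<close> on all non-constant words of length 3 occur, and from
    \<open>Suc k\<close> on the first change of letter has taken place.\<close>
  define M where "M = max m (Suc k)"
  show "\<exists>N. \<forall>w. length w \<ge> N \<and> antipalindrome w \<and> stream_prefix w u \<longrightarrow>
      (\<exists>\<Gamma>. minimal_attractor w \<Gamma> \<and> card \<Gamma> = 3)"
  proof (intro exI[of _ "length (?W M)"] allI impI)
    fix w
    assume w: "length (?W M) \<le> length w \<and> antipalindrome w \<and> stream_prefix w u"
    then obtain n where n: "w = ?W n"
      using antipalindromic_stream_prefix_cases assms by metis
    with w length_pseudostandard_prefix_less[of n M \<Delta>] have "M \<le> n" by (meson not_le)
    then have "m \<le> n" "k < n" by (auto simp: M_def)
    obtain x y z where "attractor w {x, y, z}"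
      using attractor_pseudostandard_three[of k \<Delta> a n] k \<open>0 < k\<close> \<open>k < n\<close> n by metis
    moreover have "sublist (?W m) w"
      unfolding n by (intro prefix_imp_sublist pseudostandard_prefix_mono \<open>m \<le> n\<close>)
    then have "sublist [c, d, e] w" if "\<not> (c = d \<and> d = e)" for c d e
      using that m by (meson sublist_three_of_block_pairs sublist_order.order_trans)
    then have "3 \<le> card \<Gamma>" if "attractor w \<Gamma>" for \<Gamma>
      using three_le_card_attractor that block_coded_pseudostandard_prefix n by metis
    \<comment> \<open>Distinctness of the three elements need not be shown, since the lower bound
      forces it.\<close>
    moreover have "card {x, y, z} \<le> 3" by (auto simp: card_insert_if)
    ultimately show "\<exists>\<Gamma>. minimal_attractor w \<Gamma> \<and> card \<Gamma> = 3" by (intro minimal_attractorI)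
  qed
qed

end
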